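(* In the setting described in the context, assume that $\|A(z)\|\le\sigma(z)$ for all $z\in H$ and that the parameter sequence $\{\alpha_k\}$ satisfies $\alpha_k\ge\bar\alpha$ for all $k$ and some $\bar\alpha>0$. Then the following hold. (i) Assume that the augmenting function $\sigma$ has the property that every sequence $\{w_k\}\subset H$ for which $\sigma(w_k)$ decreases to $0$ is bounded, and assume $M_P=M_D$. If the dual sequence $\{(y_k,c_k)\}$ generated by DSG-1 is bounded, then $S(D)\ne\emptyset$ and the dual sequence converges strongly to a dual solution. (ii) Assume that there exists $R>0$ such that $r_k\le R\,\sigma(z_k)$ for all $k$. Let $(\hat y,\hat c)\in H\times\mathbb{R}_+$ with $q(\hat y,\hat c)>-\infty$ and let $s\ge M_P$. Assume that one of the following holds: (a) $\sigma$ is coercive, $y_0=\hat y$ and $c_0>\hat c$; or (b) $\sigma$ is conditionally coercive with constant $K_\sigma>0$, $y_0=\hat y$, $c_0>\hat c+\frac{s-q(\hat y,\hat c)}{K_\sigma}$, and $\alpha_0s_0>\frac{M_P-q(y_0,c_0)+\tilde r}{K_\sigma\,\sigma(z_0)}$, where $\tilde r$ is an upper bound of $\{r_k\}$. If $S(D)\neq\emptyset$, then the dual sequence generated by DSG-1 is strongly convergent to some dual solution.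
   Context: Setting. $X$ is a reflexive Banach space, $H$ a Hilbert space, $\mathbb{R}_+=[0,\infty)$. A set is weakly compact if its weak closure is compact in the weak topology. An extended-real function is w-lsc (weakly lower semicontinuous) if its epigraph is weakly closed, and w-usc if its negative is w-lsc. $\varphi:X\to\mathbb{R}\cup\{+\infty\}$ is proper, w-lsc, and its level sets $\{\varphi\le\alpha\}$ are weakly compact. $M_P=\inf_X\varphi$. $f:X\times H\to[-\infty,+\infty]$ satisfies $f(x,0)=\varphi(x)$ for all $x$, is proper ($\mathrm{dom}\,f\neq\emptyset$, $f>-\infty$), w-lsc and weakly level-compact: for each $\bar z\in H$, $\alpha\in\mathbb{R}$ there are a weakly open neighbourhood $U$ of $\bar z$ and a weakly compact $B\subset X$ with $\{x:f(x,z)\le\alpha\}\subset B$ for all $z\in U$. $\sigma:H\to\mathbb{R}\cup\{+\infty\}$ is an augmenting function: proper, w-lsc, $\sigma(0)=0$, $\mathrm{argmin}\,\sigma=\{0\}$, and either coercive ($\sigma(z)\to+\infty$ as $\|z\|\to\infty$) or conditionally coercive with constant $K_\sigma>0$ (the level set $\{\sigma\le K_\sigma\}$ is bounded). $A:H\to H$ satisfies $\|A(z)\|\le\sigma(z)$ for all $z$, and $z\mapsto\langle A(z),y\rangle$ is w-usc for every $y\in H$. The dual function is $q(y,c)=\inf_{(x,z)\in X\times H}\{f(x,z)-\langle A(z),y\rangle+c\sigma(z)\}$ on $H\times\mathbb{R}_+$, with the convention $0\cdot(+\infty)=+\infty$ in $c\sigma(z)$; $M_D=\sup_{H\times\mathbb{R}_+}q$,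 and $S(D)$ is the set of $(y,c)\in H\times\mathbb{R}_+$ with $q(y,c)=M_D$ (dual solutions). It is assumed that $q(\bar y,\bar c)>-\infty$ for some $(\bar y,\bar c)\in H\times\mathbb{R}_+$. For $r\ge0$, $X_r(y,c)=\{(x,z)\in X\times H: f(x,z)-\langle A(z),y\rangle+c\sigma(z)\le q(y,c)+r\}$. Algorithm DSG. Step 0: choose $(y_0,c_0)\in H\times\mathbb{R}_+$ with $q(y_0,c_0)>-\infty$, $\epsilon>0$, $0\le\delta<1$, $\{\alpha_k\}\subset(0,\alpha)$ for some $\alpha>0$, and $\{r_k\}\subset\mathbb{R}_+$ with $r_k\to0$; $k:=0$. Step 1: (a) find $(x_k,z_k)\in X_{r_k}(y_k,c_k)$; (b) if $z_k=0$ and $r_k\le\epsilon$, stop; (c) if $z_k=0$ and $r_k>\epsilon$, replace $r_k$ by $\delta r_k$ and go to (a); (d) if $z_k\ne0$ go to Step 2. Step 2: take a stepsize $s_k>0$, set $y_{k+1}=y_k-s_kA(z_k)$, $c_{k+1}=c_k+(\alpha_k+1)s_k\sigma(z_k)$, $k:=k+1$, go to Step 1. ($r_k,x_k,z_k$ denote the final values at iteration $k$.) DSG-1 is DSG with stepsizes $s_k\in[\eta_k,\beta_k]$, $\eta_k=\min\{\eta,\|A(z_k)\|+\|z_k\|\}$, $\beta_k=\max\{\beta,\sigma(z_k)+\|z_k\|\}$, where $\beta>\eta>0$ are fixed. It is assumed that the algorithm does not stop, so $z_k\neq0$ for all $k$ and all sequences are infinite. *)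

theory Defs
  imports "HOL-Analysis.Analysis"
begin

section \<open>Weak topology\<close>

definition reflexive_space :: "'a::real_normed_vector itself \<Rightarrow> bool" where
  "reflexive_space _ \<longleftrightarrow>
     (\<forall>\<Phi> :: ('a \<Rightarrow>\<^sub>L real) \<Rightarrow>\<^sub>L real. \<exists>x :: 'a. \<forall>g. blinfun_apply \<Phi> g = blinfun_apply g x)"

definition weak_topology :: "'a::real_normed_vector topology" where
  "weak_topology = topology_generated_by {blinfun_apply g -` U |(g :: 'a \<Rightarrow>\<^sub>L real) U. open U}"

definition weakly_compact :: "'a::real_normed_vector set \<Rightarrow> bool" where
  "weakly_compact S \<longleftrightarrow> compactin weak_topology (weak_topology closure_of S)"

definition w_lsc :: "('a::real_normed_vector \<Rightarrow> ereal) \<Rightarrow> bool" where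
  "w_lsc g \<longleftrightarrow> closedin weak_topology {(x, t :: real). g x \<le> ereal t}"

definition w_usc :: "('a::real_normed_vector \<Rightarrow> ereal) \<Rightarrow> bool" where
  "w_usc g \<longleftrightarrow> w_lsc (\<lambda>x. - g x)"

definition proper_fun :: "('a \<Rightarrow> ereal) \<Rightarrow> bool" where
  "proper_fun g \<longleftrightarrow> (\<forall>x. g x > -\<infinity>) \<and> (\<exists>x. g x < \<infinity>)"

definition weakly_level_compact ::
  "('a::real_normed_vector \<times> 'h::real_normed_vector \<Rightarrow> ereal) \<Rightarrow> bool" where
  "weakly_level_compact f \<longleftrightarrow>
     (\<forall>zb. \<forall>a::real. \<exists>U B. openin weak_topology U \<and> zb \<in> U \<and> weakly_compact B \<and>
        (\<forall>z\<in>U. {x. f (x, z) \<le> ereal a} \<subseteq> B))"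

section \<open>Augmenting functions and the dual problem\<close>

definition coercive_fun :: "('h::real_normed_vector \<Rightarrow> ereal) \<Rightarrow> bool" where
  "coercive_fun \<sigma> \<longleftrightarrow> (\<sigma> \<longlongrightarrow> \<infinity>) at_infinity"

definition cond_coercive :: "('h::real_normed_vector \<Rightarrow> ereal) \<Rightarrow> real \<Rightarrow> bool" where
  "cond_coercive \<sigma> K \<longleftrightarrow> K > 0 \<and> bounded {z. \<sigma> z \<le> ereal K}"

definition augmenting_fun :: "('h::real_normed_vector \<Rightarrow> ereal) \<Rightarrow> bool" where
  "augmenting_fun \<sigma> \<longleftrightarrow>
     proper_fun \<sigma> \<and> w_lsc \<sigma> \<and> \<sigma> 0 = 0 \<and> {z. \<forall>w. \<sigma> z \<le> \<sigma> w} = {0} \<and>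
     (coercive_fun \<sigma> \<or> (\<exists>K. cond_coercive \<sigma> K))"

text \<open>In \<^typ>\<open>ereal\<close> one has \<open>0 * \<infinity> = 0\<close>; the augmented Lagrangian uses \<open>0 * \<infinity> = \<infinity>\<close> instead.\<close>

definition aug_scale :: "real \<Rightarrow> ereal \<Rightarrow> ereal" where
  "aug_scale c t = (if t = \<infinity> then \<infinity> else ereal c * t)"

definition lagr ::
  "('x \<times> 'h::real_inner \<Rightarrow> ereal) \<Rightarrow> ('h \<Rightarrow> 'h) \<Rightarrow> ('h \<Rightarrow> ereal) \<Rightarrow> 'h \<Rightarrow> real \<Rightarrow> 'x \<times> 'h \<Rightarrow> ereal" where
  "lagr f A \<sigma> y c = (\<lambda>(x, z). f (x, z) - ereal (A z \<bullet> y) + aug_scale c (\<sigma> z))"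

definition dual_fun ::
  "('x \<times> 'h::real_inner \<Rightarrow> ereal) \<Rightarrow> ('h \<Rightarrow> 'h) \<Rightarrow> ('h \<Rightarrow> ereal) \<Rightarrow> 'h \<Rightarrow> real \<Rightarrow> ereal" where
  "dual_fun f A \<sigma> y c = (INF p. lagr f A \<sigma> y c p)"

definition primal_value :: "('x \<Rightarrow> ereal) \<Rightarrow> ereal" where
  "primal_value \<phi> = (INF x. \<phi> x)"

definition dual_value ::
  "('x \<times> 'h::real_inner \<Rightarrow> ereal) \<Rightarrow> ('h \<Rightarrow> 'h) \<Rightarrow> ('h \<Rightarrow> ereal) \<Rightarrow> ereal" where
  "dual_value f A \<sigma> = (SUP (y, c) \<in> UNIV \<times> {0..}. dual_fun f A \<sigma> y c)"

definition dual_solutions ::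
  "('x \<times> 'h::real_inner \<Rightarrow> ereal) \<Rightarrow> ('h \<Rightarrow> 'h) \<Rightarrow> ('h \<Rightarrow> ereal) \<Rightarrow> ('h \<times> real) set" where
  "dual_solutions f A \<sigma> = {(y, c). c \<ge> 0 \<and> dual_fun f A \<sigma> y c = dual_value f A \<sigma>}"

definition approx_min ::
  "('x \<times> 'h::real_inner \<Rightarrow> ereal) \<Rightarrow> ('h \<Rightarrow> 'h) \<Rightarrow> ('h \<Rightarrow> ereal) \<Rightarrow> real \<Rightarrow> 'h \<Rightarrow> real \<Rightarrow> ('x \<times> 'h) set" where
  "approx_min f A \<sigma> r y c = {p. lagr f A \<sigma> y c p \<le> dual_fun f A \<sigma> y c + ereal r}"

section \<open>The deflected subgradient algorithm\<close>

text \<open>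
  \<open>dsg_step1 f A \<sigma> \<epsilon> \<delta> y c \<rho> x z r\<close>: Step 1 at the dual iterate \<open>(y, c)\<close>, entered with tolerance
  \<open>\<rho>\<close>, can be left towards Step 2 with the final values \<open>x\<close>, \<open>z\<close>, \<open>r\<close>. Rule \<open>retry\<close> is the
  reduction of the tolerance when the \<open>z\<close>-component found is \<open>0\<close>. There is no rule for stopping.
\<close>

inductive dsg_step1 ::
  "('x \<times> 'h::real_inner \<Rightarrow> ereal) \<Rightarrow> ('h \<Rightarrow> 'h) \<Rightarrow> ('h \<Rightarrow> ereal) \<Rightarrow> real \<Rightarrow> real \<Rightarrow> 'h \<Rightarrow> real \<Rightarrow>
   real \<Rightarrow> 'x \<Rightarrow> 'h \<Rightarrow> real \<Rightarrow> bool"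
  for f A \<sigma> \<epsilon> \<delta> y c where
  leave: "(x, z) \<in> approx_min f A \<sigma> r y c \<Longrightarrow> z \<noteq> 0 \<Longrightarrow> dsg_step1 f A \<sigma> \<epsilon> \<delta> y c r x z r"
| retry: "(x', 0) \<in> approx_min f A \<sigma> \<rho> y c \<Longrightarrow> \<rho> > \<epsilon> \<Longrightarrow>
          dsg_step1 f A \<sigma> \<epsilon> \<delta> y c (\<delta> * \<rho>) x z r \<Longrightarrow> dsg_step1 f A \<sigma> \<epsilon> \<delta> y c \<rho> x z r"

text \<open>
  A non-stopping run. Here \<open>\<rho>\<close> are the prescribed tolerances and \<open>r\<close> the final ones. The update of
  \<open>c\<close> is an equation in \<^typ>\<open>ereal\<close>, since \<open>\<sigma>\<close> may be infinite away from the iterates.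
\<close>

definition dsg_run ::
  "('x \<times> 'h::real_inner \<Rightarrow> ereal) \<Rightarrow> ('h \<Rightarrow> 'h) \<Rightarrow> ('h \<Rightarrow> ereal) \<Rightarrow> real \<Rightarrow> real \<Rightarrow> real \<Rightarrow>
   (nat \<Rightarrow> real) \<Rightarrow> (nat \<Rightarrow> real) \<Rightarrow> (nat \<Rightarrow> real) \<Rightarrow>
   (nat \<Rightarrow> 'h) \<Rightarrow> (nat \<Rightarrow> real) \<Rightarrow> (nat \<Rightarrow> 'x) \<Rightarrow> (nat \<Rightarrow> 'h) \<Rightarrow> (nat \<Rightarrow> real) \<Rightarrow> bool" where
  "dsg_run f A \<sigma> \<epsilon> \<delta> \<alpha>max \<alpha> \<rho> s y c x z r \<longleftrightarrow>
     c 0 \<ge> 0 \<and> dual_fun f A \<sigma> (y 0) (c 0) > -\<infinity> \<and>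
     \<epsilon> > 0 \<and> 0 \<le> \<delta> \<and> \<delta> < 1 \<and> \<alpha>max > 0 \<and> (\<forall>k. 0 < \<alpha> k \<and> \<alpha> k < \<alpha>max) \<and>
     (\<forall>k. \<rho> k \<ge> 0) \<and> \<rho> \<longlonglongrightarrow> 0 \<and>
     (\<forall>k. dsg_step1 f A \<sigma> \<epsilon> \<delta> (y k) (c k) (\<rho> k) (x k) (z k) (r k)) \<and>
     (\<forall>k. s k > 0 \<and>
        y (Suc k) = y k - s k *\<^sub>R A (z k) \<and>
        ereal (c (Suc k)) = ereal (c k) + ereal ((\<alpha> k + 1) * s k) * \<sigma> (z k))"

definition dsg1_stepsizes ::
  "('h::real_normed_vector \<Rightarrow> 'h) \<Rightarrow> ('h \<Rightarrow> ereal) \<Rightarrow> real \<Rightarrow> real \<Rightarrow> (nat \<Rightarrow> real) \<Rightarrow> (nat \<Rightarrow> 'h) \<Rightarrow> bool" where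
  "dsg1_stepsizes A \<sigma> \<eta> \<beta> s z \<longleftrightarrow>
     0 < \<eta> \<and> \<eta> < \<beta> \<and>
     (\<forall>k. min \<eta> (norm (A (z k)) + norm (z k)) \<le> s k \<and>
          ereal (s k) \<le> max (ereal \<beta>) (\<sigma> (z k) + ereal (norm (z k))))"

end

theory Submission
  imports Defs
begin

text \<open>
  Subtracting the subgradient inequality at a dual point \<open>(v, t)\<close> from the update of \<open>y\<close> bounds the
  growth of \<open>(norm (y k - v))\<^sup>2\<close>. In part (ii) the penalty keeps \<open>\<sigma> (z k)\<close> and \<open>z k\<close> bounded, and
  if \<open>(v, t)\<close> is a dual solution and \<open>c k\<close> is large, each step decreases \<open>(norm (y k - v))\<^sup>2\<close> by at
  least \<open>s k * \<sigma> (z k)\<close>; so these decrements are summable, and \<open>c\<close> is bounded after all.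
  Boundedness of \<open>c\<close> in turn means that the sum of the \<open>s k * \<sigma> (z k)\<close> converges, which
  makes \<open>y\<close> a Cauchy sequence and forces \<open>\<sigma> (z k)\<close> to be small infinitely often. In part (ii) the
  subgradient inequality then shows that the limit is dual optimal. In part (i) a subsequence of
  \<open>z\<close> converges weakly to \<open>0\<close>, and weak level-compactness of \<open>f\<close> bounds the primal value by the dual
  function at the limit.
\<close>

section \<open>Weak limits along filters\<close>

text \<open>The quadratic functional \<open>J\<close> attains its infimum, since minimising
  sequences are Cauchy by the parallelogram identity. Its first variation at the minimiser must
  vanish, which says that the minimiser represents \<open>L\<close>.\<close>

lemma riesz_representation:
  fixes L :: "'h::{real_inner, banach} \<Rightarrow> real"
  assumes "bounded_linear L"
  shows "\<exists>p. \<forall>w. L w = p \<bullet> w"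
proof -
  interpret L: bounded_linear L by fact
  define J where "J w = w \<bullet> w - 2 * L w" for w
  define m where "m = Inf (range J)"
  obtain K where K: "\<And>w. \<bar>L w\<bar> \<le> norm w * K"
    using L.bounded by auto
  have J_lower: "- K\<^sup>2 \<le> J w" for w
  proof -
    have "0 \<le> (norm w - K)\<^sup>2" by simp
    then show ?thesis
      using K[of w] unfolding J_def
      by (simp add: power2_diff power2_norm_eq_inner algebra_simps)
  qed
  then have "bdd_below (range J)" by (auto intro!: bdd_belowI)
  then have m_le: "m \<le> J w" for w
    unfolding m_def by (intro cInf_lower) auto
  have "\<exists>w. J w < m + 1 / real (Suc n)" for n
    using cInf_lessD[of "range J" "m + 1 / real (Suc n)"] unfolding m_def by auto
  then obtain w where w: "\<And>n. J (w n) < m + 1 / real (Suc n)" by metis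
  \<comment> \<open>The midpoint of \<open>u\<close> and \<open>v\<close> also has value at least
    \<open>m\<close>, so near-minimisers are close to each other.\<close>
  have par: "norm (u - v) ^ 2 \<le> 2 * (J u - m) + 2 * (J v - m)" for u v
  proof -
    have "norm (u - v) ^ 2 = 2 * J u + 2 * J v - 4 * J ((1/2) *\<^sub>R (u + v))"
      unfolding J_def power2_norm_eq_inner
      by (simp add: L.scaleR L.add inner_diff inner_add inner_commute algebra_simps)
    then show ?thesis using m_le[of "(1/2) *\<^sub>R (u + v)"] by simp
  qed
  have "Cauchy w"
  proof (rule metric_CauchyI)
    fix e :: real assume "e > 0"
    then obtain N where N: "N \<noteq> 0" "1 / real N < e\<^sup>2 / 4"
      using real_arch_inverse[of "e\<^sup>2 / 4"] by (auto simp: field_simps)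
    have J_N: "J (w n) - m < e\<^sup>2 / 4" if "n \<ge> N" for n
    proof -
      have "1 / real (Suc n) \<le> 1 / real N" using that N by (simp add: frac_le)
      then show ?thesis using w[of n] N by linarith
    qed
    have "dist (w i) (w j) < e" if "i \<ge> N" "j \<ge> N" for i j
    proof -
      have "(dist (w i) (w j))\<^sup>2 < e\<^sup>2"
        using par[of "w i" "w j"] J_N[OF that(1)] J_N[OF that(2)] by (simp add: dist_norm)
      then show ?thesis using \<open>e > 0\<close> by (simp add: power_less_imp_less_base)
    qed
    then show "\<exists>M. \<forall>i\<ge>M. \<forall>j\<ge>M. dist (w i) (w j) < e" by blast
  qed
  then obtain p where p: "w \<longlonglongrightarrow> p" by (auto simp: Cauchy_convergent_iff convergent_def)
  have "(\<lambda>n. J (w n)) \<longlonglongrightarrow> J p"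
    unfolding J_def by (intro tendsto_intros p L.tendsto)
  moreover have "(\<lambda>n. m + 1 / real (Suc n)) \<longlonglongrightarrow> m + 0"
    by (intro tendsto_intros LIMSEQ_Suc[OF lim_1_over_n])
  ultimately have Jp: "J p \<le> m"
    using LIMSEQ_le[of "\<lambda>n. J (w n)" "J p" "\<lambda>n. m + 1 / real (Suc n)" "m + 0"] w
    by (auto intro: less_imp_le)
  have "L v = p \<bullet> v" for v
  proof -
    define a where "a = 2 * (p \<bullet> v - L v)"
    define b where "b = v \<bullet> v"
    have b0: "b \<ge> 0" by (simp add: b_def)
    have "0 \<le> a * t + b * t\<^sup>2" for t
    proof -
      have "J (p + t *\<^sub>R v) = J p + a * t + b * t\<^sup>2"
        unfolding J_def a_def b_def
        by (simp add: L.scaleR L.add inner_add inner_commute power2_eq_square algebra_simps)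
      then show ?thesis using m_le[of "p + t *\<^sub>R v"] Jp by simp
    qed
    \<comment> \<open>At this \<open>t\<close> the quadratic is negative unless
      \<open>a = 0\<close>; the divisor \<open>b + 1\<close> is positive even for
      \<open>v = 0\<close>.\<close>
    from this[of "- a / (b + 1)"] have "0 \<le> - (a\<^sup>2 / (b + 1)) + b * (a\<^sup>2 / (b + 1)\<^sup>2)"
      by (simp add: power2_eq_square)
    also have "\<dots> = - (a\<^sup>2 / (b + 1)\<^sup>2)"
      using b0 by (simp add: divide_simps power2_eq_square) (simp add: algebra_simps)
    finally have "a\<^sup>2 / (b + 1)\<^sup>2 \<le> 0" by simp
    then have "a = 0" using b0 by (simp add: divide_le_0_iff zero_less_power)
    then show ?thesis by (simp add: a_def)
  qed
  then show ?thesis by blast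
qed

section \<open>Weak convergence tested on neighbourhoods and epigraphs\<close>

definition weak_limit :: "('k \<Rightarrow> 'a::real_normed_vector) \<Rightarrow> 'a \<Rightarrow> 'k filter \<Rightarrow> bool" where
  "weak_limit z p G \<longleftrightarrow> (\<forall>g :: 'a \<Rightarrow>\<^sub>L real. ((\<lambda>k. blinfun_apply g (z k)) \<longlongrightarrow> blinfun_apply g p) G)"

lemma weak_limit_tendsto: "(z \<longlongrightarrow> p) G \<Longrightarrow> weak_limit z p G"
  unfolding weak_limit_def by (auto intro: tendsto_intros)

lemma weak_limit_functional:
  fixes T :: "'a::real_normed_vector \<Rightarrow> real"
  assumes "weak_limit z p G" "bounded_linear T"
  shows "((\<lambda>k. T (z k)) \<longlongrightarrow> T p) G"
  using assms(1)[unfolded weak_limit_def, rule_format, of "Blinfun T"]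
  by (simp add: bounded_linear_Blinfun_apply[OF assms(2)])

lemma weak_limit_linear:
  assumes "weak_limit z p G" "bounded_linear T"
  shows "weak_limit (\<lambda>k. T (z k)) (T p) G"
  unfolding weak_limit_def
  by (intro allI weak_limit_functional[OF assms(1)]
      bounded_linear_compose[OF blinfun.bounded_linear_right assms(2)])

lemma weak_limit_add_const:
  "weak_limit z p G \<Longrightarrow> weak_limit (\<lambda>k. z k + e) (p + e) G"
  unfolding weak_limit_def by (simp add: blinfun.add_right tendsto_add)

lemma topspace_weak_topology [simp]: "topspace (weak_topology :: 'a::real_normed_vector topology) = UNIV"
proof -
  have "x \<in> blinfun_apply (0 :: 'a \<Rightarrow>\<^sub>L real) -` UNIV" for x :: 'a by simp
  then show ?thesis
    unfolding weak_topology_def topology_generated_by_topspace by blast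
qed

text \<open>Induction over the generation of the weak topology. For a subbasic set, the functional
  \<open>g\<close> is pulled back along \<open>T\<close>, and its tolerance \<open>d\<close> is
  shared equally between \<open>T v\<close> and \<open>e k\<close>. The gain is one \<open>V\<close>
  that works for all its members at once, as a covering argument requires.\<close>

lemma openin_weak_topology_eventually_shift:
  fixes T :: "'a::real_normed_vector \<Rightarrow> 'b::real_normed_vector"
  assumes "openin weak_topology W" and "bounded_linear T" and e: "weak_limit e e0 G"
    and "T u + e0 \<in> W"
  shows "\<exists>V. openin weak_topology V \<and> u \<in> V \<and> (\<forall>\<^sub>F k in G. \<forall>v\<in>V. T v + e k \<in> W)"
  using openin_topology_generated_by[OF assms(1)[unfolded weak_topology_def]] \<open>T u + e0 \<in> W\<close>
proof induction
  case Empty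
  then show ?case by simp
next
  case (Int a b)
  then obtain V V' where
    "openin weak_topology V \<and> u \<in> V \<and> (\<forall>\<^sub>F k in G. \<forall>v\<in>V. T v + e k \<in> a)"
    "openin weak_topology V' \<and> u \<in> V' \<and> (\<forall>\<^sub>F k in G. \<forall>v\<in>V'. T v + e k \<in> b)"
    by auto
  then show ?case
    by (intro exI[of _ "V \<inter> V'"]) (auto elim: eventually_elim2)
next
  case (UN K)
  then obtain k where "k \<in> K" "T u + e0 \<in> k" by auto
  with UN obtain V where
    "openin weak_topology V \<and> u \<in> V \<and> (\<forall>\<^sub>F j in G. \<forall>v\<in>V. T v + e j \<in> k)"
    by blast
  with \<open>k \<in> K\<close> show ?case
    by (intro exI[of _ V]) (force elim: eventually_mono)
next
  case (Basis W)
  then obtain g :: "'b \<Rightarrow>\<^sub>L real" and U where W: "W = blinfun_apply g -` U" and "open U" by auto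
  with Basis obtain d where d: "d > 0" "\<And>t. dist t (g (T u + e0)) < d \<Longrightarrow> t \<in> U"
    unfolding open_dist by auto
  define h where "h = Blinfun (\<lambda>v. g (T v))"
  have h: "blinfun_apply h v = g (T v)" for v
    unfolding h_def using bounded_linear_compose[OF blinfun.bounded_linear_right[of g] assms(2)]
    by (simp add: bounded_linear_Blinfun_apply)
  define V where "V = blinfun_apply h -` ball (h u) (d/2)"
  have "openin weak_topology V"
    unfolding weak_topology_def V_def by (rule topology_generated_by_Basis) blast
  moreover have "u \<in> V" using d by (simp add: V_def)
  moreover have "\<forall>\<^sub>F k in G. \<forall>v\<in>V. T v + e k \<in> W"
  proof -
    have "\<forall>\<^sub>F k in G. dist (g (e k)) (g e0) < d/2"
      using e d unfolding weak_limit_def by (intro tendstoD) auto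
    then show ?thesis
    proof (rule eventually_mono, intro ballI)
      fix k v assume "dist (g (e k)) (g e0) < d/2" "v \<in> V"
      moreover from this have "dist (g (T v)) (g (T u)) < d/2"
        by (simp add: V_def h dist_commute)
      ultimately have "dist (g (T v + e k)) (g (T u + e0)) < d"
        unfolding blinfun.add_right by (intro le_less_trans[OF dist_triangle_add]) simp
      then show "T v + e k \<in> W"
        unfolding W vimage_eq by (rule d(2))
    qed
  qed
  ultimately show ?case by blast
qed

lemma openin_weak_topology_eventually:
  assumes "openin weak_topology W" "weak_limit z p G" "p \<in> W"
  shows "\<forall>\<^sub>F k in G. z k \<in> W"
  using openin_weak_topology_eventually_shift[of W "\<lambda>v::'a. 0" z p G 0] assms
  by (auto simp: bounded_linear_zero elim: eventually_mono)

text \<open>The points \<open>(z k, b)\<close> have constant height and tend weakly to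
  \<open>(p, b)\<close>. If the limit were outside the weakly closed epigraph, they would eventually
  be outside as well.\<close>

lemma w_lsc_weak_limit:
  assumes g: "w_lsc g" and "G \<noteq> bot" and "weak_limit z p G" and ev: "\<forall>\<^sub>F k in G. g (z k) \<le> ereal b"
  shows "g p \<le> ereal b"
proof (rule ccontr)
  assume "\<not> g p \<le> ereal b"
  let ?W = "UNIV - {(x, t :: real). g x \<le> ereal t}"
  have "openin weak_topology ?W"
    using g unfolding w_lsc_def closedin_def by simp
  moreover have "weak_limit (\<lambda>k. (z k, b)) (p, b) G"
    using weak_limit_add_const[OF weak_limit_linear[OF assms(3), of "\<lambda>v. (v, 0)"], of "(0, b)"]
    by (simp add: bounded_linear_Pair)
  ultimately have "\<forall>\<^sub>F k in G. (z k, b) \<in> ?W"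
    using \<open>\<not> g p \<le> ereal b\<close> by (intro openin_weak_topology_eventually) auto
  with ev have "\<forall>\<^sub>F k in G. False" by eventually_elim simp
  with \<open>G \<noteq> bot\<close> show False by simp
qed

text \<open>A tube argument: the \<open>x k\<close> eventually stay in one weakly compact set. If
  the epigraph missed every \<open>((u, p), b)\<close>, finitely many neighbourhoods would cover
  that set and avoid the epigraph for all late \<open>z k\<close>. The \<open>x k\<close> themselves
  need not converge.\<close>

lemma weakly_level_compact_limit:
  fixes f :: "'a::real_normed_vector \<times> 'b::real_normed_vector \<Rightarrow> ereal"
  assumes f: "w_lsc f" "weakly_level_compact f" and "G \<noteq> bot" and z: "weak_limit z p G"
    and ev: "\<forall>\<^sub>F k in G. f (x k, z k) \<le> ereal b"
  shows "\<exists>u. f (u, p) \<le> ereal b"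
proof (rule ccontr)
  assume neg: "\<nexists>u. f (u, p) \<le> ereal b"
  obtain U B where U: "openin weak_topology U" "p \<in> U" and "weakly_compact B"
    and B: "\<And>v. v \<in> U \<Longrightarrow> {u. f (u, v) \<le> ereal b} \<subseteq> B"
    using f(2) unfolding weakly_level_compact_def by meson
  define L where "L = weak_topology closure_of B"
  have L: "compactin weak_topology L" "B \<subseteq> L"
    using \<open>weakly_compact B\<close> unfolding weakly_compact_def L_def by (auto simp: closure_of_subset)
  let ?W = "UNIV - {(q, t :: real). f q \<le> ereal t}"
  have W: "openin weak_topology ?W"
    using f(1) unfolding w_lsc_def closedin_def by simp
  \<comment> \<open>The splitting for the shift lemma: \<open>e\<close> carries the moving
    \<open>z k\<close> and the height, while \<open>T\<close> injects the first coordinate.\<close>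
  have e: "weak_limit (\<lambda>k. ((0, z k), b)) ((0 :: 'a, p), b) G"
    using weak_limit_add_const[OF weak_limit_linear[OF z, of "\<lambda>v. ((0 :: 'a, v), 0 :: real)"], of "((0, 0), b)"]
    by (simp add: bounded_linear_Pair)
  have "\<exists>V. openin weak_topology V \<and> u \<in> V \<and> (\<forall>\<^sub>F k in G. \<forall>v\<in>V. ((v, z k), b) \<in> ?W)" for u
    using openin_weak_topology_eventually_shift[OF W _ e, of "\<lambda>v. ((v, 0), 0)" u] neg
    by (simp add: bounded_linear_Pair)
  then have "\<forall>u. \<exists>V. openin weak_topology V \<and> u \<in> V \<and> (\<forall>\<^sub>F k in G. \<forall>v\<in>V. ((v, z k), b) \<in> ?W)"
    by (rule allI)
  from choice[OF this] obtain V where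
    V': "\<forall>u. openin weak_topology (V u) \<and> u \<in> V u \<and> (\<forall>\<^sub>F k in G. \<forall>v\<in>V u. ((v, z k), b) \<in> ?W)"
    by (rule exE)
  have V: "openin weak_topology (V u)" "u \<in> V u"
    and V_ev: "\<forall>\<^sub>F k in G. \<forall>v\<in>V u. ((v, z k), b) \<in> ?W" for u
    using V'[THEN spec, of u] by blast+
  have "\<forall>N \<in> range V. openin weak_topology N" "L \<subseteq> \<Union>(range V)"
    using V by auto
  with L(1) obtain \<F> where "finite \<F>" "\<F> \<subseteq> range V" "L \<subseteq> \<Union>\<F>"
    unfolding compactin_def by meson
  moreover from this obtain D where "finite D" "\<F> = V ` D"
    by (meson finite_subset_image)
  ultimately have D: "finite D" "L \<subseteq> (\<Union>u\<in>D. V u)" by simp_all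
  have "\<forall>\<^sub>F k in G. \<forall>u\<in>D. \<forall>v\<in>V u. ((v, z k), b) \<in> ?W"
    using D(1) V_ev by (intro eventually_ball_finite) blast+
  moreover have "\<forall>\<^sub>F k in G. z k \<in> U"
    using U z by (intro openin_weak_topology_eventually)
  ultimately have "\<forall>\<^sub>F k in G. False"
    using ev
  proof eventually_elim
    case (elim k)
    then have "x k \<in> L" using B[of "z k"] L(2) by auto
    with elim D(2) show False by blast
  qed
  with \<open>G \<noteq> bot\<close> show False by simp
qed

section \<open>Weak cluster points of bounded sequences\<close>

text \<open>\<open>F\<close> is refined by the preimages of the neighbourhoods of a cluster point;
  the refinement is proper because the point is a cluster point.\<close>

lemma compact_cluster_filter:
  assumes "compact C" and "\<And>k. a k \<in> C" and "F \<noteq> bot"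
  shows "\<exists>G \<le> F. G \<noteq> bot \<and> (\<exists>l. (a \<longlongrightarrow> l) G)"
proof -
  obtain l where l: "inf (nhds l) (filtermap a F) \<noteq> bot"
    using assms unfolding compact_filter by (metis eventually_filtermap eventually_True always_eventually filtermap_bot_iff)
  define G where "G = inf (filtercomap a (nhds l)) F"
  have "G \<noteq> bot"
  proof
    assume "G = bot"
    then obtain Q P where "eventually Q (nhds l)" "eventually P F" "\<And>k. Q (a k) \<Longrightarrow> P k \<Longrightarrow> False"
      unfolding trivial_limit_def G_def eventually_inf eventually_filtercomap by blast
    then have "eventually (\<lambda>t. \<not> Q t) (filtermap a F)"
      unfolding eventually_filtermap by (auto intro: eventually_mono[OF \<open>eventually P F\<close>])
    with \<open>eventually Q (nhds l)\<close> have "eventually (\<lambda>_. False) (inf (nhds l) (filtermap a F))"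
      unfolding eventually_inf by blast
    with l show False by simp
  qed
  moreover have "(a \<longlongrightarrow> l) G"
    unfolding G_def filterlim_iff_le_filtercomap by simp
  ultimately show ?thesis unfolding G_def by (meson inf_le2)
qed

lemma tendsto_coordinate:
  fixes a :: "'k \<Rightarrow> 'i \<Rightarrow> 'b::topological_space"
  assumes "(a \<longlongrightarrow> l) F"
  shows "((\<lambda>k. a k i) \<longlongrightarrow> l i) F"
proof (rule topological_tendstoI)
  fix S :: "'b set" assume "open S" "l i \<in> S"
  moreover from this have "open ((\<lambda>g. g i) -` S)"
    using continuous_on_product_coordinates by (intro open_vimage)
  ultimately show "\<forall>\<^sub>F k in F. a k i \<in> S"
    using topological_tendstoD[OF assms, of "(\<lambda>g. g i) -` S"] by simp
qed

text \<open>The Banach-Alaoglu argument: the functionals given by inner products with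
  \<open>z k\<close> lie in a product of compact intervals, so they have a pointwise limit along a
  finer filter. Linearity and boundedness pass to this limit, and Riesz representation turns it into
  a vector.\<close>

lemma bounded_imp_weak_limit:
  fixes z :: "nat \<Rightarrow> 'h::{real_inner, banach}"
  assumes "bounded (range z)"
  shows "\<exists>G \<le> sequentially. G \<noteq> bot \<and> (\<exists>p. weak_limit z p G)"
proof -
  obtain M where M: "\<And>k. norm (z k) \<le> M"
    using assms by (meson bounded_iff rangeI)
  let ?C = "PiE UNIV (\<lambda>w::'h. {- (M * norm w) .. M * norm w})"
  have "compact ?C"
    using compactin_PiE[of "\<lambda>_. euclidean" UNIV "\<lambda>w::'h. {- (M * norm w) .. M * norm w}"]
    by (simp add: euclidean_product_topology)
  moreover have zw: "\<bar>z k \<bullet> w\<bar> \<le> M * norm w" for k w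
    by (meson Cauchy_Schwarz_ineq2 M mult_right_mono norm_ge_zero order_trans)
  ultimately obtain G L where G: "G \<le> sequentially" "G \<noteq> bot" and L: "((\<lambda>k w. z k \<bullet> w) \<longlongrightarrow> L) G"
    using compact_cluster_filter[of ?C "\<lambda>k w. z k \<bullet> w" sequentially]
    by (fastforce simp: abs_le_iff)
  have Lw: "((\<lambda>k. z k \<bullet> w) \<longlongrightarrow> L w) G" for w
    by (rule tendsto_coordinate[OF L])
  have "bounded_linear L"
  proof (rule bounded_linear_intro)
    show "L (u + v) = L u + L v" for u v
      using tendsto_unique[OF G(2) Lw[of "u + v"]] tendsto_add[OF Lw Lw, of u v]
      by (simp add: inner_add_right)
    show "L (r *\<^sub>R v) = r *\<^sub>R L v" for r v
      using tendsto_unique[OF G(2) Lw[of "r *\<^sub>R v"]] tendsto_mult[OF tendsto_const Lw, of r v]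
      by simp
    show "norm (L v) \<le> norm v * M" for v
      using tendsto_upperbound[OF tendsto_norm[OF Lw] _ G(2), of v "norm v * M"] zw
      by (simp add: mult.commute)
  qed
  then obtain p where p: "\<And>w. L w = p \<bullet> w" using riesz_representation by blast
  have "weak_limit z p G"
    unfolding weak_limit_def
  proof
    fix g :: "'h \<Rightarrow>\<^sub>L real"
    obtain q where "\<And>w. g w = q \<bullet> w"
      using riesz_representation[OF blinfun.bounded_linear_right] by blast
    then show "((\<lambda>k. g (z k)) \<longlongrightarrow> g p) G"
      using Lw[of q] p[of q] by (simp add: inner_commute)
  qed
  with G show ?thesis by blast
qed

section \<open>Duality\<close>

text \<open>A retry multiplies the tolerance by \<open>\<delta> < 1\<close>, so the final tolerance
  inherits nonnegativity and the bound by the prescribed one.\<close>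

lemma dsg_step1_leave:
  assumes "dsg_step1 f A \<sigma> \<epsilon> \<delta> y c \<rho> x z r" "0 \<le> \<rho>" "0 \<le> \<delta>" "\<delta> < 1"
  shows "(x, z) \<in> approx_min f A \<sigma> r y c \<and> z \<noteq> 0 \<and> 0 \<le> r \<and> r \<le> \<rho>"
  using assms
proof induction
  case (leave x z r)
  then show ?case by simp
next
  case (retry x' \<rho> x z r)
  moreover have "\<delta> * \<rho> \<le> \<rho>" using retry.prems by (simp add: mult_left_le_one_le)
  ultimately show ?case by auto
qed

lemma augmenting_fun_nonneg: "augmenting_fun \<sigma> \<Longrightarrow> 0 \<le> \<sigma> w"
  unfolding augmenting_fun_def by (metis (mono_tags, lifting) mem_Collect_eq singletonI)

lemma augmenting_fun_nonpos_iff: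
  assumes "augmenting_fun \<sigma>"
  shows "\<sigma> w \<le> 0 \<longleftrightarrow> w = 0"
proof
  assume "\<sigma> w \<le> 0"
  then have "w \<in> {z. \<forall>w. \<sigma> z \<le> \<sigma> w}"
    using augmenting_fun_nonneg[OF assms] by (auto intro: order_trans)
  then show "w = 0" using assms unfolding augmenting_fun_def by simp
qed (use assms in \<open>simp add: augmenting_fun_def\<close>)

lemma lagr_finite:
  assumes "f (u, w) = ereal a" "\<sigma> w = ereal b"
  shows "lagr f A \<sigma> v t (u, w) = ereal (a - A w \<bullet> v + t * b)"
  using assms by (simp add: lagr_def aug_scale_def)

text \<open>Upper semicontinuity of an infimum of functions that are affine in \<open>(v, t)\<close>
  or identically infinite: a point \<open>(u, w)\<close> witnessing the strict inequality at the
  limit still witnesses it nearby.\<close>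

lemma dual_fun_usc:
  fixes v :: "'k \<Rightarrow> 'h::real_inner"
  assumes f: "\<And>p. f p > -\<infinity>" and \<sigma>: "\<And>w. 0 \<le> \<sigma> w"
    and "(v \<longlongrightarrow> v') G" "(t \<longlongrightarrow> t') G" and "dual_fun f A \<sigma> v' t' < ereal b"
  shows "\<forall>\<^sub>F k in G. dual_fun f A \<sigma> (v k) (t k) < ereal b"
proof -
  obtain u w where l: "lagr f A \<sigma> v' t' (u, w) < ereal b"
    using assms(5) unfolding dual_fun_def by (auto simp: INF_less_iff)
  \<comment> \<open>The convention in \<open>aug_scale\<close> matters here: it excludes an infinite
    \<open>\<sigma> w\<close> even when \<open>t' = 0\<close>.\<close>
  have "f (u, w) \<noteq> \<infinity>" "\<sigma> w \<noteq> \<infinity>"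
    using l f[of "(u, w)"] by (auto simp: lagr_def aug_scale_def)
  then obtain a d where ad: "f (u, w) = ereal a" "\<sigma> w = ereal d"
    using f[of "(u, w)"] \<sigma>[of w] by (cases "f (u, w)"; cases "\<sigma> w") auto
  have "((\<lambda>k. a - A w \<bullet> v k + t k * d) \<longlongrightarrow> a - A w \<bullet> v' + t' * d) G"
    by (intro tendsto_intros assms)
  moreover have "a - A w \<bullet> v' + t' * d < b"
    using l by (simp add: lagr_finite[of f u w a \<sigma> d, OF ad])
  ultimately have "\<forall>\<^sub>F k in G. a - A w \<bullet> v k + t k * d < b"
    by (rule order_tendstoD)
  then show ?thesis
  proof eventually_elim
    case (elim k)
    have "dual_fun f A \<sigma> (v k) (t k) \<le> lagr f A \<sigma> (v k) (t k) (u, w)"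
      unfolding dual_fun_def by (rule INF_lower) simp
    also have "\<dots> < ereal b"
      using elim by (simp add: lagr_finite[of f u w a \<sigma> d, OF ad])
    finally show ?case .
  qed
qed

text \<open>Weak duality: at the points \<open>(u, 0)\<close> the Lagrangian does not depend on the
  dual variables.\<close>

lemma dual_fun_le_primal_value:
  assumes "\<And>u. f (u, 0) = \<phi> u" "A 0 = 0" "\<sigma> 0 = 0"
  shows "dual_fun f A \<sigma> v t \<le> primal_value \<phi>"
  unfolding primal_value_def
proof (rule INF_greatest)
  fix u
  have "dual_fun f A \<sigma> v t \<le> lagr f A \<sigma> v t (u, 0)"
    unfolding dual_fun_def by (rule INF_lower) simp
  also have "\<dots> = \<phi> u"
    using assms by (simp add: lagr_def aug_scale_def zero_ereal_def[symmetric])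
  finally show "dual_fun f A \<sigma> v t \<le> \<phi> u" .
qed

text \<open>Weak lower semicontinuity bounds \<open>\<sigma> p\<close> by every positive
  \<open>e\<close>, and 0 is the only point where \<open>\<sigma>\<close> is not positive.\<close>

lemma weak_limit_zero_of_augmenting:
  assumes "augmenting_fun \<sigma>" "G \<noteq> bot" "weak_limit z p G" "((\<lambda>k. \<sigma> (z k)) \<longlongrightarrow> 0) G"
  shows "p = 0"
proof -
  have "\<sigma> p \<le> ereal e" if "e > 0" for e
  proof (rule w_lsc_weak_limit[OF _ assms(2,3)])
    show "w_lsc \<sigma>" using assms(1) by (simp add: augmenting_fun_def)
    show "\<forall>\<^sub>F k in G. \<sigma> (z k) \<le> ereal e"
      using order_tendstoD(2)[OF assms(4), of "ereal e"] that
      by (auto elim: eventually_mono)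
  qed
  then have "\<sigma> p \<le> 0"
    by (intro ereal_le_epsilon2[of "\<sigma> p" 0]) simp
  then show ?thesis using augmenting_fun_nonpos_iff assms(1) by blast
qed

lemma coercive_fun_sublevel_bounded:
  assumes "coercive_fun \<sigma>"
  shows "bounded {w. \<sigma> w \<le> ereal a}"
proof -
  have "\<forall>\<^sub>F w in at_infinity. ereal a < \<sigma> w"
    using order_tendstoD(1)[OF assms[unfolded coercive_fun_def], of "ereal a"] by simp
  then obtain b where "\<And>w. norm w \<ge> b \<Longrightarrow> ereal a < \<sigma> w"
    unfolding eventually_at_infinity by auto
  then have "norm w \<le> b" if "\<sigma> w \<le> ereal a" for w
    using that by (meson leD linear)
  then show ?thesis unfolding bounded_iff by auto
qed

text \<open>Positivity of the terms lets the next index be chosen with a value below the current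
  one. Monotonicity is what makes the boundedness property of \<open>\<sigma>\<close> in part (i)
  applicable.\<close>

lemma frequently_small_decseq:
  fixes a :: "nat \<Rightarrow> real"
  assumes pos: "\<And>k. a k > 0" and small: "\<And>e. e > 0 \<Longrightarrow> \<exists>\<^sub>F k in sequentially. a k < e"
  shows "\<exists>h. strict_mono h \<and> decseq (a \<circ> h) \<and> (a \<circ> h) \<longlonglongrightarrow> 0"
proof -
  have next_ix: "\<exists>k>n. a k < e" if "e > 0" for e n
    using small[OF that] unfolding frequently_sequentially by (meson Suc_le_eq)
  have "\<exists>h. \<forall>n. a (h n) < 1 / real (Suc n) \<and> (h n < h (Suc n) \<and> a (h (Suc n)) \<le> a (h n))"
  proof (rule dependent_nat_choice)
    show "\<exists>k. a k < 1 / real (Suc 0)" using next_ix[of 1 0] by auto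
    show "\<exists>l. a l < 1 / real (Suc (Suc n)) \<and> k < l \<and> a l \<le> a k" for k n
      using next_ix[of "min (1 / real (Suc (Suc n))) (a k)" k] pos[of k] by auto
  qed
  then obtain h where h: "\<And>n. a (h n) < 1 / real (Suc n)"
    "\<And>n. h n < h (Suc n) \<and> a (h (Suc n)) \<le> a (h n)" by blast
  have "(a \<circ> h) \<longlonglongrightarrow> 0"
  proof (rule tendsto_sandwich[OF _ _ tendsto_const LIMSEQ_Suc[OF lim_1_over_n]])
    show "\<forall>\<^sub>F n in sequentially. 0 \<le> (a \<circ> h) n" using pos by (simp add: less_imp_le)
    show "\<forall>\<^sub>F n in sequentially. (a \<circ> h) n \<le> 1 / real (Suc n)"
      using h(1) by (simp add: less_imp_le)
  qed
  with h(2) show ?thesis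
    by (intro exI[of _ h]) (auto simp: strict_mono_Suc_iff decseq_Suc_iff)
qed

section \<open>The dual sequence\<close>

locale dsg1 =
  fixes \<phi> :: "'x::banach \<Rightarrow> ereal"
    and f :: "'x \<times> 'h::{real_inner, banach} \<Rightarrow> ereal"
    and A :: "'h \<Rightarrow> 'h"
    and \<sigma> :: "'h \<Rightarrow> ereal"
    and \<epsilon> \<delta> \<alpha>max \<eta> \<beta> :: real
    and \<alpha> \<rho> s c r :: "nat \<Rightarrow> real"
    and x :: "nat \<Rightarrow> 'x"
    and y z :: "nat \<Rightarrow> 'h"
  assumes proper_\<phi>: "proper_fun \<phi>"
    and f_zero: "\<And>u. f (u, 0) = \<phi> u"
    and proper_f: "proper_fun f" and lsc_f: "w_lsc f" and level_f: "weakly_level_compact f"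
    and aug: "augmenting_fun \<sigma>"
    and A_le: "\<And>w. ereal (norm (A w)) \<le> \<sigma> w"
    and run: "dsg_run f A \<sigma> \<epsilon> \<delta> \<alpha>max \<alpha> \<rho> s y c x z r"
    and stepsizes: "dsg1_stepsizes A \<sigma> \<eta> \<beta> s z"
begin

text \<open>Infinite values are sent to 0 by \<open>real_of_ereal\<close>, so these real versions
  are meaningful only through the lemmas \<open>sg\<close>, \<open>fv\<close>, \<open>qv\<close> and
  \<open>pv\<close>, which prove finiteness.\<close>

definition sg :: "nat \<Rightarrow> real" where "sg k = real_of_ereal (\<sigma> (z k))"

definition fv :: "nat \<Rightarrow> real" where "fv k = real_of_ereal (f (x k, z k))"

definition qv :: "nat \<Rightarrow> real" where "qv k = real_of_ereal (dual_fun f A \<sigma> (y k) (c k))"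

definition pv :: real where "pv = real_of_ereal (primal_value \<phi>)"

section \<open>Finiteness and basic inequalities along the run\<close>

lemma \<sigma>_zero: "\<sigma> 0 = 0" using aug by (simp add: augmenting_fun_def)

lemma A_zero: "A 0 = 0" using A_le[of 0] by (simp add: \<sigma>_zero)

lemma f_ninf: "f p > -\<infinity>" using proper_f unfolding proper_fun_def by blast

lemma s_pos: "s k > 0" using run by (simp add: dsg_run_def)

lemma \<alpha>_pos: "\<alpha> k > 0" and \<alpha>_less: "\<alpha> k < \<alpha>max" using run by (auto simp: dsg_run_def)

lemma step1: "(x k, z k) \<in> approx_min f A \<sigma> (r k) (y k) (c k)" "z k \<noteq> 0" "0 \<le> r k" "r k \<le> \<rho> k"
  using dsg_step1_leave[of f A \<sigma> \<epsilon> \<delta> "y k" "c k" "\<rho> k" "x k" "z k" "r k"] run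
  by (auto simp: dsg_run_def)

lemma r_tendsto: "r \<longlonglongrightarrow> 0"
  by (rule tendsto_sandwich[OF _ _ tendsto_const, of _ _ _ \<rho>])
    (use run step1 in \<open>auto simp: dsg_run_def\<close>)

text \<open>An infinite \<open>\<sigma> (z k)\<close> would make the right side of the update of
  \<open>c\<close> infinite, whereas \<open>c (Suc k)\<close> is real. Positivity comes from
  \<open>z k \<noteq> 0\<close>.\<close>

lemma sg: "\<sigma> (z k) = ereal (sg k)" and sg_pos: "sg k > 0"
proof -
  have pos: "\<sigma> (z k) > 0"
    using augmenting_fun_nonpos_iff[OF aug, of "z k"] step1(2)[of k] by auto
  have "(\<alpha> k + 1) * s k > 0" using s_pos[of k] \<alpha>_pos[of k] by simp
  moreover have "ereal a * \<infinity> = \<infinity>" if "a > 0" for a using that by simp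
  ultimately have "ereal ((\<alpha> k + 1) * s k) * \<infinity> = \<infinity>" by blast
  moreover have "ereal (c (Suc k)) = ereal (c k) + ereal ((\<alpha> k + 1) * s k) * \<sigma> (z k)"
    using run by (simp add: dsg_run_def)
  ultimately have "ereal (c (Suc k)) = ereal (c k) + \<infinity>" if "\<sigma> (z k) = \<infinity>"
    unfolding that by (simp only:)
  then have "\<sigma> (z k) \<noteq> \<infinity>" by auto
  with pos show "\<sigma> (z k) = ereal (sg k)" unfolding sg_def by (cases "\<sigma> (z k)") auto
  with pos show "sg k > 0" by simp
qed

lemma c_Suc: "c (Suc k) = c k + (\<alpha> k + 1) * (s k * sg k)"
proof -
  have "ereal (c (Suc k)) = ereal (c k) + ereal ((\<alpha> k + 1) * s k) * \<sigma> (z k)"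
    using run by (simp add: dsg_run_def)
  then show ?thesis by (simp add: sg mult.assoc)
qed

lemma y_Suc: "y (Suc k) = y k - s k *\<^sub>R A (z k)"
  using run by (simp add: dsg_run_def)

lemma norm_A: "norm (A (z k)) \<le> sg k"
  using A_le[of "z k"] by (simp add: sg)

lemma ssg_pos: "s k * sg k > 0" using s_pos sg_pos by simp

lemma ssg_le: "s k * sg k \<le> c (Suc k) - c k"
  using ssg_pos[of k] \<alpha>_pos[of k] by (simp add: c_Suc distrib_right)

lemma c_strict_mono: "strict_mono c"
  by (rule strict_monoI_Suc) (use ssg_le ssg_pos in \<open>smt (verit)\<close>)

lemma c_nonneg: "0 \<le> c k"
proof -
  have "0 \<le> c 0" using run by (simp add: dsg_run_def)
  also have "c 0 \<le> c k" using c_strict_mono by (simp add: strict_mono_less_eq)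
  finally show ?thesis .
qed

lemma dual_le_primal: "dual_fun f A \<sigma> v t \<le> primal_value \<phi>"
  using f_zero A_zero \<sigma>_zero by (rule dual_fun_le_primal_value)

lemma primal_less_top: "primal_value \<phi> < \<infinity>"
proof -
  obtain u where "\<phi> u < \<infinity>" using proper_\<phi> by (auto simp: proper_fun_def)
  then show ?thesis unfolding primal_value_def by (meson INF_lower UNIV_I le_less_trans)
qed

text \<open>Weak duality bounds the dual value above, so approximate minimality makes
  \<open>f (x k, z k)\<close> finite. The Lagrangian is then real at this point and keeps the dual
  value above minus infinity.\<close>

lemma fv: "f (x k, z k) = ereal (fv k)"
  and qv: "dual_fun f A \<sigma> (y k) (c k) = ereal (qv k)"
  and approx: "fv k - A (z k) \<bullet> y k + c k * sg k \<le> qv k + r k"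
proof -
  let ?q = "dual_fun f A \<sigma> (y k) (c k)"
  have l: "lagr f A \<sigma> (y k) (c k) (x k, z k) \<le> ?q + ereal (r k)"
    using step1(1)[of k] by (simp add: approx_min_def)
  have q: "?q < \<infinity>" using dual_le_primal primal_less_top by (rule le_less_trans)
  have "f (x k, z k) \<noteq> \<infinity>"
    using l q by (auto simp: lagr_def aug_scale_def sg)
  then show fv: "f (x k, z k) = ereal (fv k)"
    using f_ninf[of "(x k, z k)"] unfolding fv_def by (cases "f (x k, z k)") auto
  note lf = lagr_finite[of f "x k" "z k" "fv k" \<sigma> "sg k" A, OF fv sg]
  show "?q = ereal (qv k)"
    using l q unfolding lf qv_def by (cases ?q) auto
  with l show "fv k - A (z k) \<bullet> y k + c k * sg k \<le> qv k + r k"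
    unfolding lf by simp
qed

lemma pv: "primal_value \<phi> = ereal pv"
  using primal_less_top dual_le_primal[of "y 0" "c 0"] unfolding pv_def qv
  by (cases "primal_value \<phi>") auto

lemma qv_le_pv: "qv k \<le> pv"
  using dual_le_primal[of "y k" "c k"] by (simp add: qv pv)

text \<open>The pair \<open>(- A (z k), sg k)\<close> is a supergradient of the dual function at
  \<open>(y k, c k)\<close> up to \<open>r k\<close>: the Lagrangian at \<open>(v, t)\<close> is
  evaluated at the current approximate minimiser.\<close>

lemma dual_fun_le_subgradient:
  "dual_fun f A \<sigma> v t \<le> ereal (qv k + r k + A (z k) \<bullet> (y k - v) + (t - c k) * sg k)"
proof -
  have "dual_fun f A \<sigma> v t \<le> lagr f A \<sigma> v t (x k, z k)"
    unfolding dual_fun_def by (rule INF_lower) simp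
  also have "\<dots> = ereal (fv k - A (z k) \<bullet> v + t * sg k)"
    by (intro lagr_finite fv sg)
  also have "\<dots> \<le> ereal (qv k + r k + A (z k) \<bullet> (y k - v) + (t - c k) * sg k)"
    using approx[of k] by (simp add: inner_diff_right algebra_simps)
  finally show ?thesis .
qed

lemma dual_le_dual_value: "t \<ge> 0 \<Longrightarrow> dual_fun f A \<sigma> v t \<le> dual_value f A \<sigma>"
  unfolding dual_value_def by (rule SUP_upper2[of "(v, t)"]) auto

lemma dual_value_le_primal: "dual_value f A \<sigma> \<le> primal_value \<phi>"
  unfolding dual_value_def by (rule SUP_least) (auto intro: dual_le_primal)

lemma qv_eventually_less:
  assumes "y \<longlonglongrightarrow> v" "c \<longlonglongrightarrow> t" "dual_fun f A \<sigma> v t < ereal b"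
  shows "\<forall>\<^sub>F k in sequentially. qv k < b"
  using dual_fun_usc[of f, OF f_ninf augmenting_fun_nonneg[OF aug] assms] by (simp add: qv)

text \<open>Since \<open>f\<close> restricts to \<open>\<phi>\<close> where its second argument is
  0, level bounds on iterates whose \<open>z\<close> tends weakly to 0 reach the primal
  value.\<close>

lemma pv_le_of_level:
  assumes "G \<noteq> bot" "weak_limit (\<lambda>k. z (h k)) 0 G" "\<forall>\<^sub>F k in G. fv (h k) \<le> b"
  shows "pv \<le> b"
proof -
  have "\<exists>u. f (u, 0) \<le> ereal b"
    using weakly_level_compact_limit[OF lsc_f level_f assms(1,2), of "\<lambda>k. x (h k)"] assms(3)
    by (simp add: fv)
  then obtain u where "\<phi> u \<le> ereal b" by (auto simp: f_zero)
  then have "primal_value \<phi> \<le> ereal b"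
    unfolding primal_value_def by (meson INF_lower UNIV_I order_trans)
  then show ?thesis by (simp add: pv)
qed

section \<open>Convergence of the dual sequence when \<open>c\<close> is bounded\<close>

text \<open>The increments of \<open>c\<close> telescope and dominate \<open>s k * sg k\<close>,
  which in turn dominates the norm of the step of \<open>y\<close>; hence the steps of
  \<open>y\<close> form an absolutely convergent series.\<close>

lemma bounded_c_imp_convergent:
  assumes "bounded (range c)"
  obtains v t where "y \<longlonglongrightarrow> v" "c \<longlonglongrightarrow> t" "t \<ge> 0" "summable (\<lambda>k. s k * sg k)"
proof -
  obtain B where B: "\<And>k. c k \<le> B"
    using assms unfolding bounded_iff by (auto simp: abs_le_iff)
  obtain t where t: "c \<longlonglongrightarrow> t"
    using incseq_convergent[of c B] B strict_mono_mono[OF c_strict_mono]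
    by blast
  have sum: "summable (\<lambda>k. s k * sg k)"
  proof (rule bounded_imp_summable)
    show "0 \<le> s k * sg k" for k using ssg_pos by (simp add: less_imp_le)
    show "(\<Sum>k\<le>n. s k * sg k) \<le> B - c 0" for n
    proof -
      have "(\<Sum>k\<le>n. s k * sg k) \<le> (\<Sum>k\<le>n. c (Suc k) - c k)"
        by (intro sum_mono ssg_le)
      also have "\<dots> = c (Suc n) - c 0" by (induction n) simp_all
      finally show ?thesis using B[of "Suc n"] by simp
    qed
  qed
  have "summable (\<lambda>k. s k *\<^sub>R A (z k))"
    by (rule summable_comparison_test'[OF sum, of 0])
      (use s_pos norm_A in \<open>auto intro!: mult_left_mono simp: less_imp_le\<close>)
  then have "(\<lambda>n. y 0 - (\<Sum>k<n. s k *\<^sub>R A (z k))) \<longlonglongrightarrow> y 0 - (\<Sum>k. s k *\<^sub>R A (z k))"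
    by (intro tendsto_intros summable_LIMSEQ)
  moreover have "y 0 - (\<Sum>k<n. s k *\<^sub>R A (z k)) = y n" for n
    by (induction n) (simp_all add: y_Suc)
  ultimately have "y \<longlonglongrightarrow> y 0 - (\<Sum>k. s k *\<^sub>R A (z k))" by (simp only:)
  moreover have "t \<ge> 0" using t c_nonneg by (intro LIMSEQ_le_const[of c]) auto
  ultimately show ?thesis using that t sum by blast
qed

text \<open>
  If \<open>\<sigma> (z k)\<close> stayed away from \<open>0\<close>, the steps and hence the \<open>z k\<close> themselves would tend to \<open>0\<close>,
  and the limit of the \<open>f (x k, z k)\<close> would lie strictly below the primal value, because the
  penalty term does not vanish.
\<close>

lemma frequently_sg_small:
  assumes "y \<longlonglongrightarrow> v" "c \<longlonglongrightarrow> t" "summable (\<lambda>k. s k * sg k)" and "e > 0"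
  shows "\<exists>\<^sub>F k in sequentially. sg k < e"
proof (rule ccontr)
  assume "\<not> (\<exists>\<^sub>F k in sequentially. sg k < e)"
  then have ge: "\<forall>\<^sub>F k in sequentially. e \<le> sg k"
    by (simp add: not_frequently not_less)
  have "(\<lambda>k. s k * sg k / e) \<longlonglongrightarrow> 0"
    using tendsto_divide[OF summable_LIMSEQ_zero[OF assms(3)] tendsto_const, of e] \<open>e > 0\<close> by simp
  then have s0: "s \<longlonglongrightarrow> 0"
  proof (rule tendsto_sandwich[OF _ _ tendsto_const, rotated 2])
    show "\<forall>\<^sub>F k in sequentially. 0 \<le> s k" using s_pos by (simp add: less_imp_le)
    show "\<forall>\<^sub>F k in sequentially. s k \<le> s k * sg k / e"
      using ge by eventually_elim (use s_pos \<open>e > 0\<close> in \<open>simp add: pos_le_divide_eq\<close>)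
  qed
  have \<eta>: "\<eta> > 0" and lower: "min \<eta> (norm (A (z k)) + norm (z k)) \<le> s k" for k
    using stepsizes by (auto simp: dsg1_stepsizes_def)
  \<comment> \<open>Once \<open>s k < \<eta>\<close>, the minimum in the lower stepsize bound must
    be its second argument.\<close>
  have "(\<lambda>k. norm (A (z k)) + norm (z k)) \<longlonglongrightarrow> 0"
  proof (rule tendsto_sandwich[OF _ _ tendsto_const s0])
    show "\<forall>\<^sub>F k in sequentially. norm (A (z k)) + norm (z k) \<le> s k"
      using order_tendstoD(2)[OF s0 \<eta>]
    proof eventually_elim
      case (elim k)
      then show ?case using lower[of k] by linarith
    qed
  qed simp
  then have z0: "z \<longlonglongrightarrow> 0" and Az0: "(\<lambda>k. A (z k)) \<longlonglongrightarrow> 0"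
    by (rule Lim_null_comparison[rotated], simp)+
  have "(\<lambda>k. r k + A (z k) \<bullet> y k) \<longlonglongrightarrow> 0 + 0 \<bullet> v"
    by (intro tendsto_intros r_tendsto Az0 assms)
  \<comment> \<open>Index 1 because \<open>c 0\<close> may be 0; the penalty parameter is positive
    after one step.\<close>
  moreover have c1: "c 1 > 0"
    using c_nonneg[of 0] strict_monoD[OF c_strict_mono, of 0 1] by simp
  ultimately have small: "\<forall>\<^sub>F k in sequentially. r k + A (z k) \<bullet> y k < c 1 * e / 2"
    using \<open>e > 0\<close> by (intro order_tendstoD(2)) auto
  have "\<forall>\<^sub>F k in sequentially. fv k \<le> pv - c 1 * e / 2"
    using ge small eventually_ge_at_top[of 1]
  proof eventually_elim
    case (elim k)
    have "c 1 * e \<le> c k * sg k"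
      using elim c1 \<open>e > 0\<close> c_strict_mono by (intro mult_mono) (auto simp: strict_mono_less_eq c_nonneg)
    then show ?case using elim approx[of k] qv_le_pv[of k] by simp
  qed
  then have "pv \<le> pv - c 1 * e / 2"
    by (intro pv_le_of_level[of sequentially "\<lambda>k. k"] weak_limit_tendsto z0) auto
  then show False using c1 \<open>e > 0\<close> by (simp add: mult_le_0_iff)
qed

lemma sg_subseq:
  assumes "y \<longlonglongrightarrow> v" "c \<longlonglongrightarrow> t" "summable (\<lambda>k. s k * sg k)"
  obtains h where "strict_mono h" "decseq (sg \<circ> h)" "(sg \<circ> h) \<longlonglongrightarrow> 0"
  using frequently_small_decseq[of sg, OF sg_pos frequently_sg_small[OF assms]] by blast

lemma A_inner_subseq:
  assumes "y \<longlonglongrightarrow> v" "strict_mono h" "(sg \<circ> h) \<longlonglongrightarrow> 0"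
  shows "(\<lambda>k. A (z (h k)) \<bullet> y (h k)) \<longlonglongrightarrow> 0" "(\<lambda>k. A (z (h k))) \<longlonglongrightarrow> 0"
proof -
  show *: "(\<lambda>k. A (z (h k))) \<longlonglongrightarrow> 0"
    by (rule Lim_null_comparison[OF _ assms(3)]) (simp add: norm_A)
  have "(\<lambda>k. A (z (h k)) \<bullet> y (h k)) \<longlonglongrightarrow> 0 \<bullet> v"
    using LIMSEQ_subseq_LIMSEQ[OF assms(1,2)] by (intro tendsto_intros *) (simp add: comp_def)
  then show "(\<lambda>k. A (z (h k)) \<bullet> y (h k)) \<longlonglongrightarrow> 0" by simp
qed

text \<open>If the dual function at the limit were below the primal value, upper semicontinuity
  would hold \<open>qv\<close> below some \<open>b < pv\<close>. Along indices with
  \<open>sg\<close> tending to 0 the remaining terms of \<open>approx\<close> are null or have a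
  favourable sign, so \<open>fv\<close> would stay strictly below \<open>pv\<close> while
  \<open>z\<close> tends weakly to 0.\<close>

lemma convergent_to_dual_solution:
  assumes dec: "\<And>w :: nat \<Rightarrow> 'h. decseq (\<lambda>k. \<sigma> (w k)) \<Longrightarrow> (\<lambda>k. \<sigma> (w k)) \<longlonglongrightarrow> 0 \<Longrightarrow> bounded (range w)"
    and gap: "primal_value \<phi> = dual_value f A \<sigma>"
    and bdd: "bounded (range c)"
  shows "\<exists>d \<in> dual_solutions f A \<sigma>. (\<lambda>k. (y k, c k)) \<longlonglongrightarrow> d"
proof -
  obtain v t where v: "y \<longlonglongrightarrow> v" and t: "c \<longlonglongrightarrow> t" "t \<ge> 0" and sum: "summable (\<lambda>k. s k * sg k)"
    using bdd by (rule bounded_c_imp_convergent)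
  obtain h where h: "strict_mono h" "decseq (sg \<circ> h)" "(sg \<circ> h) \<longlonglongrightarrow> 0"
    using sg_subseq[OF v t(1) sum] .
  have \<sigma>h: "(\<lambda>k. \<sigma> (z (h k))) \<longlonglongrightarrow> 0"
    using h(3) by (simp add: sg comp_def zero_ereal_def)
  have "bounded (range (\<lambda>k. z (h k)))"
    using h(2) \<sigma>h by (intro dec) (auto simp: sg decseq_def)
  then obtain G p where G: "G \<le> sequentially" "G \<noteq> bot" and p: "weak_limit (\<lambda>k. z (h k)) p G"
    using bounded_imp_weak_limit by blast
  have p0: "p = 0"
    using aug G(2) p tendsto_mono[OF G(1) \<sigma>h] by (rule weak_limit_zero_of_augmenting)
  have "primal_value \<phi> \<le> dual_fun f A \<sigma> v t"
  proof (rule ccontr)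
    assume "\<not> primal_value \<phi> \<le> dual_fun f A \<sigma> v t"
    then obtain b where b: "dual_fun f A \<sigma> v t < ereal b" "b < pv"
      using ereal_dense2[of "dual_fun f A \<sigma> v t" "ereal pv"] by (auto simp: pv not_le)
    have "\<forall>\<^sub>F k in sequentially. qv (h k) < b"
      using qv_eventually_less[OF v t(1) b(1)] eventually_subseq[OF h(1)] by blast
    moreover have "(\<lambda>k. r (h k) + A (z (h k)) \<bullet> y (h k)) \<longlonglongrightarrow> 0 + 0"
      using LIMSEQ_subseq_LIMSEQ[OF r_tendsto h(1)] A_inner_subseq(1)[OF v h(1,3)]
      by (intro tendsto_add) (simp_all add: comp_def)
    then have "\<forall>\<^sub>F k in sequentially. r (h k) + A (z (h k)) \<bullet> y (h k) < (pv - b) / 2"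
      using b(2) by (intro order_tendstoD(2)) auto
    ultimately have "\<forall>\<^sub>F k in sequentially. fv (h k) \<le> (pv + b) / 2"
    proof eventually_elim
      case (elim k)
      \<comment> \<open>The penalty term is simply dropped; half of the gap \<open>pv - b\<close>
        absorbs the null terms.\<close>
      have "0 \<le> c (h k) * sg (h k)" using c_nonneg sg_pos by (simp add: less_imp_le)
      then show ?case using elim approx[of "h k"] by argo
    qed
    then have "pv \<le> (pv + b) / 2"
      using p p0 by (intro pv_le_of_level[OF G(2)]) (auto intro: filter_leD[OF G(1)])
    then show False using b(2) by simp
  qed
  then have "(v, t) \<in> dual_solutions f A \<sigma>"
    using t(2) dual_le_dual_value[of t v] by (simp add: dual_solutions_def gap antisym)
  then show ?thesis using tendsto_Pair[OF v t(1)] by blast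
qed

section \<open>Bounds on the iterates for part (ii)\<close>

text \<open>The subgradient inequality at \<open>(y 0, t)\<close>. The distance from
  \<open>y 0\<close> to \<open>y k\<close> is at most the sum of the \<open>s j * sg j\<close>; the
  same sum occurs in \<open>c k - c 0\<close> and cancels, leaving only the part weighted by
  \<open>\<alpha>\<close>.\<close>

lemma penalty_le:
  assumes "dual_fun f A \<sigma> (y 0) t = ereal q"
  shows "sg k * (c 0 - t + (\<Sum>j<k. \<alpha> j * (s j * sg j))) \<le> pv + r k - q"
proof -
  have "q \<le> qv k + r k + A (z k) \<bullet> (y k - y 0) + (t - c k) * sg k"
    using dual_fun_le_subgradient[of "y 0" t k] assms by simp
  moreover have "A (z k) \<bullet> (y k - y 0) \<le> sg k * (\<Sum>j<k. s j * sg j)"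
  proof -
    have "norm (y k - y 0) \<le> (\<Sum>j<k. s j * sg j)"
    proof (induction k)
      case (Suc k)
      have "norm (y (Suc k) - y 0) \<le> norm (y k - y 0) + norm (s k *\<^sub>R A (z k))"
        using norm_triangle_ineq4[of "y k - y 0" "s k *\<^sub>R A (z k)"] by (simp add: y_Suc algebra_simps)
      also have "norm (s k *\<^sub>R A (z k)) \<le> s k * sg k"
        using s_pos[of k] norm_A[of k] by (auto intro!: mult_left_mono simp: less_imp_le)
      finally show ?case using Suc by simp
    qed simp
    then have "norm (A (z k)) * norm (y k - y 0) \<le> sg k * (\<Sum>j<k. s j * sg j)"
      using norm_A[of k] by (intro mult_mono) (auto simp: less_imp_le[OF sg_pos])
    then show ?thesis using norm_cauchy_schwarz order_trans by blast
  qed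
  moreover have "c k = c 0 + (\<Sum>j<k. s j * sg j) + (\<Sum>j<k. \<alpha> j * (s j * sg j))"
    by (induction k) (simp_all add: c_Suc algebra_simps)
  ultimately show ?thesis using qv_le_pv[of k] by (simp add: algebra_simps)
qed

lemma r_bounded: obtains B where "\<And>k. r k \<le> B"
proof -
  obtain B where "\<And>k. norm (r k) \<le> B"
    using r_tendsto by (meson BseqE convergentI convergent_imp_Bseq)
  then show ?thesis using that[of B] by (simp add: abs_le_iff)
qed

text \<open>Dropping the nonnegative sum in \<open>penalty_le\<close> leaves the fixed positive
  factor \<open>c 0 - t\<close> on \<open>sg k\<close>.\<close>

lemma coercive_bounded:
  assumes "coercive_fun \<sigma>" "dual_fun f A \<sigma> (y 0) t > -\<infinity>" "c 0 > t"
  shows "bounded (range sg) \<and> bounded (range z)"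
proof -
  have "dual_fun f A \<sigma> (y 0) t < \<infinity>" using dual_le_primal primal_less_top by (rule le_less_trans)
  then obtain q where q: "dual_fun f A \<sigma> (y 0) t = ereal q"
    using assms(2) by (cases "dual_fun f A \<sigma> (y 0) t") auto
  obtain B where B: "\<And>k. r k \<le> B" using r_bounded by blast
  have le: "sg k \<le> (pv + B - q) / (c 0 - t)" for k
  proof -
    have "0 \<le> (\<Sum>j<k. \<alpha> j * (s j * sg j))"
      using \<alpha>_pos ssg_pos by (intro sum_nonneg) (simp add: less_imp_le)
    then have "sg k * (c 0 - t) \<le> sg k * (c 0 - t + (\<Sum>j<k. \<alpha> j * (s j * sg j)))"
      using sg_pos[of k] by (intro mult_left_mono) auto
    also have "\<dots> \<le> pv + B - q" using penalty_le[OF q, of k] B[of k] by simp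
    finally show ?thesis using assms(3) by (simp add: pos_le_divide_eq)
  qed
  then have "bounded (range sg)"
    unfolding bounded_iff using sg_pos by (auto simp: less_imp_le)
  moreover have "bounded (range z)"
    by (rule bounded_subset[OF coercive_fun_sublevel_bounded[OF assms(1)]]) (use le in \<open>auto simp: sg\<close>)
  ultimately show ?thesis by simp
qed

text \<open>With \<open>t = c 0\<close>, \<open>penalty_le\<close> retains only the weighted sum.
  Its first term is large enough by hypothesis to force \<open>sg k < K\<close>. Index 0, where the
  sum is empty, contributes just one extra point to each range.\<close>

lemma cond_coercive_bounded:
  assumes "cond_coercive \<sigma> K" and rt: "\<And>k. r k \<le> rt"
    and large: "ereal (\<alpha> 0 * s 0) >
      (primal_value \<phi> - dual_fun f A \<sigma> (y 0) (c 0) + ereal rt) / (ereal K * \<sigma> (z 0))"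
  shows "bounded (range sg) \<and> bounded (range z)"
proof -
  have K: "K > 0" using assms(1) by (simp add: cond_coercive_def)
  then have "(pv - qv 0 + rt) / (K * sg 0) < \<alpha> 0 * s 0"
    using large sg_pos[of 0] by (simp add: pv qv sg)
  then have K_large: "pv - qv 0 + rt < K * (\<alpha> 0 * (s 0 * sg 0))"
    using K sg_pos[of 0] by (simp add: pos_divide_less_eq mult_ac)
  have less: "sg k < K" if "k \<noteq> 0" for k
  proof -
    have a0: "\<alpha> 0 * (s 0 * sg 0) > 0" using \<alpha>_pos ssg_pos by simp
    have "\<alpha> 0 * (s 0 * sg 0) \<le> (\<Sum>j<k. \<alpha> j * (s j * sg j))"
      using that \<alpha>_pos ssg_pos
      by (intro member_le_sum[of 0 "{..<k}" "\<lambda>j. \<alpha> j * (s j * sg j)"]) (auto simp: less_imp_le)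
    then have "sg k * (\<alpha> 0 * (s 0 * sg 0)) \<le> sg k * (\<Sum>j<k. \<alpha> j * (s j * sg j))"
      using sg_pos[of k] by (intro mult_left_mono) auto
    also have "\<dots> < K * (\<alpha> 0 * (s 0 * sg 0))"
      using penalty_le[OF qv, of k] rt[of k] K_large by simp
    finally show ?thesis using a0 by (simp add: mult_less_cancel_right)
  qed
  then have "sg k \<in> insert (sg 0) {0..K}" for k
    using sg_pos[of k] by (cases "k = 0") (auto simp: less_imp_le)
  then have "range sg \<subseteq> insert (sg 0) {0..K}" by blast
  then have "bounded (range sg)" by (rule bounded_subset[rotated]) simp
  moreover have "z k \<in> insert (z 0) {w. \<sigma> w \<le> ereal K}" for k
    using less[of k] by (cases "k = 0") (auto simp: sg less_imp_le)
  then have "range z \<subseteq> insert (z 0) {w. \<sigma> w \<le> ereal K}" by blast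
  then have "bounded (range z)"
    by (rule bounded_subset[rotated]) (use assms(1) in \<open>simp add: cond_coercive_def\<close>)
  ultimately show ?thesis by simp
qed

text \<open>After expanding the square, the subgradient inequality at \<open>(v, t)\<close> controls
  the cross term, with \<open>r k\<close> absorbed as a multiple of \<open>sg k\<close>, and
  \<open>norm_A\<close> controls the quadratic term.\<close>

lemma norm_y_Suc_le:
  assumes q: "dual_fun f A \<sigma> v t = ereal q" "qv k \<le> q" and R: "r k \<le> R * sg k"
  shows "(norm (y (Suc k) - v))\<^sup>2 \<le>
    (norm (y k - v))\<^sup>2 + s k * sg k * (2 * (R + t - c k) + s k * sg k)"
proof -
  have "q \<le> qv k + r k + A (z k) \<bullet> (y k - v) + (t - c k) * sg k"
    using dual_fun_le_subgradient[of v t k] q(1) by simp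
  then have "- (A (z k) \<bullet> (y k - v)) \<le> (R + t - c k) * sg k"
    using q(2) R by (simp add: algebra_simps)
  then have 1: "2 * s k * - (A (z k) \<bullet> (y k - v)) \<le> 2 * s k * ((R + t - c k) * sg k)"
    using s_pos[of k] by (intro mult_left_mono) auto
  have 2: "(s k)\<^sup>2 * (norm (A (z k)))\<^sup>2 \<le> (s k)\<^sup>2 * (sg k)\<^sup>2"
    using norm_A[of k] by (intro mult_left_mono power_mono) auto
  have "(norm (y (Suc k) - v))\<^sup>2 =
    (norm (y k - v))\<^sup>2 + 2 * s k * - (A (z k) \<bullet> (y k - v)) + (s k)\<^sup>2 * (norm (A (z k)))\<^sup>2"
    unfolding y_Suc power2_norm_eq_inner
    by (simp add: inner_diff inner_commute power2_eq_square algebra_simps)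
  with 1 2 show ?thesis by (simp add: power2_eq_square algebra_simps)
qed

text \<open>
  As soon as \<open>c k\<close> is large, \<open>(norm (y k - v))\<^sup>2 + c k / (1 + \<alpha>max)\<close> no longer increases, so \<open>c\<close>
  cannot be unbounded.
\<close>

lemma c_bounded:
  assumes q: "dual_fun f A \<sigma> v t = ereal q" "\<And>k. qv k \<le> q" and R: "\<And>k. r k \<le> R * sg k"
    and bdd: "bounded (range sg)" "bounded (range z)"
  shows "bounded (range c)"
proof (rule ccontr)
  assume nb: "\<not> bounded (range c)"
  obtain B1 B2 where B: "\<And>k. norm (sg k) \<le> B1" "\<And>k. norm (z k) \<le> B2"
    using bdd by (meson bounded_iff rangeI)
  have upper: "s k \<le> max \<beta> (sg k + norm (z k))" for k
  proof -
    have "ereal (s k) \<le> max (ereal \<beta>) (\<sigma> (z k) + ereal (norm (z k)))"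
      using stepsizes by (simp add: dsg1_stepsizes_def)
    then show ?thesis by (simp add: sg max_def split: if_splits)
  qed
  define P where "P = max \<beta> (B1 + B2) * B1"
  have P: "s k * sg k \<le> P" for k
  proof -
    have "s k \<le> max \<beta> (B1 + B2)" "sg k \<le> B1"
      using upper[of k] B[of k] by auto
    then show ?thesis unfolding P_def
      using s_pos[of k] sg_pos[of k] by (intro mult_mono) auto
  qed
  have am: "1 + \<alpha>max > 0" using \<alpha>_pos[of 0] \<alpha>_less[of 0] by simp
  \<comment> \<open>The divisor exceeds \<open>\<alpha> k + 1\<close>, so the second summand grows
    by at most \<open>s k * sg k\<close> per step, which the first one loses once \<open>c k\<close>
    is large.\<close>
  define V where "V k = (norm (y k - v))\<^sup>2 + c k / (1 + \<alpha>max)" for k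
  have big: "\<exists>k. b < c k" for b
  proof (rule ccontr)
    assume "\<nexists>k. b < c k"
    then have "range c \<subseteq> {0..b}" using c_nonneg by (auto simp: not_less)
    then show False using nb bounded_subset bounded_closed_interval by blast
  qed
  \<comment> \<open>Beyond this threshold the bracket in \<open>norm_y_Suc_le\<close> is at most
    -1.\<close>
  obtain N where N: "R + t + P + 1 < c N" using big by blast
  have V_Suc: "V (Suc k) \<le> V k" if "k \<ge> N" for k
  proof -
    have "c N \<le> c k" using that c_strict_mono by (simp add: strict_mono_less_eq)
    then have "2 * (R + t - c k) + s k * sg k \<le> - 1"
      using N P[of k] ssg_pos[of k] by (simp add: algebra_simps)
    then have "s k * sg k * (2 * (R + t - c k) + s k * sg k) \<le> s k * sg k * (- 1)"
      using ssg_pos[of k] by (intro mult_left_mono) auto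
    then have "(norm (y (Suc k) - v))\<^sup>2 \<le> (norm (y k - v))\<^sup>2 - s k * sg k"
      using norm_y_Suc_le[OF q(1) q(2) R, of k] by linarith
    moreover have "c (Suc k) / (1 + \<alpha>max) \<le> c k / (1 + \<alpha>max) + s k * sg k"
    proof -
      have "(\<alpha> k + 1) * (s k * sg k) \<le> (1 + \<alpha>max) * (s k * sg k)"
        using \<alpha>_less[of k] ssg_pos[of k] by (intro mult_right_mono) auto
      then have "c (Suc k) / (1 + \<alpha>max) \<le> (c k + (1 + \<alpha>max) * (s k * sg k)) / (1 + \<alpha>max)"
        using am by (intro divide_right_mono) (auto simp: c_Suc)
      then show ?thesis using am by (simp add: add_divide_distrib)
    qed
    ultimately show ?thesis unfolding V_def by linarith
  qed
  have "V k \<le> V N" if "k \<ge> N" for k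
    using that by (induction k rule: dec_induct) (auto intro: order_trans[OF V_Suc])
  \<comment> \<open>Exceeding \<open>c N\<close> places \<open>k\<close> beyond \<open>N\<close>,
    since \<open>c\<close> increases; exceeding the other bound contradicts
    \<open>V k \<le> V N\<close>.\<close>
  moreover obtain k where k: "max (c N) ((1 + \<alpha>max) * V N) < c k" using big by blast
  then have "k \<ge> N"
    using strict_mono_less[OF c_strict_mono] by (simp add: less_imp_le)
  ultimately have "c k / (1 + \<alpha>max) \<le> V N"
    unfolding V_def by (smt (verit) zero_le_power2)
  with k am show False by (simp add: pos_divide_le_eq mult.commute)
qed

text \<open>The given dual solution serves twice: as the centre for \<open>c_bounded\<close>, and as
  the point at which the subgradient inequality is read along indices with \<open>sg\<close> tending
  to 0. There it forces \<open>qv\<close> up to the dual value, and upper semicontinuity passes this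
  on to the limit.\<close>

lemma dual_solution_limit:
  assumes d: "d \<in> dual_solutions f A \<sigma>" and R: "\<And>k. r k \<le> R * sg k"
    and bdd: "bounded (range sg)" "bounded (range z)"
  shows "\<exists>d \<in> dual_solutions f A \<sigma>. (\<lambda>k. (y k, c k)) \<longlonglongrightarrow> d"
proof -
  obtain v' t' where d': "dual_fun f A \<sigma> v' t' = dual_value f A \<sigma>"
    using d by (auto simp: dual_solutions_def)
  have qv_le: "ereal (qv k) \<le> dual_value f A \<sigma>" for k
    using dual_le_dual_value[OF c_nonneg, of "y k" k] by (simp add: qv)
  \<comment> \<open>The dual value is real because it lies between \<open>qv 0\<close> and
    \<open>pv\<close>.\<close>
  then obtain q where q: "dual_value f A \<sigma> = ereal q"
    using dual_value_le_primal qv_le[of 0] by (cases "dual_value f A \<sigma>") (auto simp: pv)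
  have "bounded (range c)"
    using d' qv_le R bdd by (intro c_bounded[of v' t' q R]) (auto simp: q)
  then obtain v t where v: "y \<longlonglongrightarrow> v" and t: "c \<longlonglongrightarrow> t" "t \<ge> 0" and sum: "summable (\<lambda>k. s k * sg k)"
    by (rule bounded_c_imp_convergent)
  obtain h where h: "strict_mono h" "(sg \<circ> h) \<longlonglongrightarrow> 0"
    using sg_subseq[OF v t(1) sum] by blast
  have "ereal q \<le> dual_fun f A \<sigma> v t"
  proof (rule ccontr)
    assume "\<not> ereal q \<le> dual_fun f A \<sigma> v t"
    then obtain b where b: "dual_fun f A \<sigma> v t < ereal b" "b < q"
      using ereal_dense2[of "dual_fun f A \<sigma> v t" "ereal q"] by (auto simp: not_le)
    have "\<forall>\<^sub>F k in sequentially. qv (h k) < b"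
      using qv_eventually_less[OF v t(1) b(1)] eventually_subseq[OF h(1)] by blast
    \<comment> \<open>These are the terms by which the bound on the optimal value at
      \<open>(v', t')\<close> exceeds \<open>qv (h k)\<close>.\<close>
    moreover have "(\<lambda>k. r (h k) + A (z (h k)) \<bullet> (y (h k) - v') + (t' - c (h k)) * sg (h k))
        \<longlonglongrightarrow> 0 + 0 \<bullet> (v - v') + (t' - t) * 0"
      using LIMSEQ_subseq_LIMSEQ[OF r_tendsto h(1)] LIMSEQ_subseq_LIMSEQ[OF v h(1)]
        LIMSEQ_subseq_LIMSEQ[OF t(1) h(1)] A_inner_subseq(2)[OF v h] h(2)
      by (intro tendsto_intros) (simp_all add: comp_def)
    then have "\<forall>\<^sub>F k in sequentially.
        r (h k) + A (z (h k)) \<bullet> (y (h k) - v') + (t' - c (h k)) * sg (h k) < q - b"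
      using b(2) by (intro order_tendstoD(2)) auto
    ultimately have "\<forall>\<^sub>F k in sequentially. False"
    proof eventually_elim
      case (elim k)
      then show ?case using dual_fun_le_subgradient[of v' t' "h k"] d' q by simp
    qed
    then show False by simp
  qed
  then have "(v, t) \<in> dual_solutions f A \<sigma>"
    using t(2) dual_le_dual_value[of t v] by (simp add: dual_solutions_def q antisym)
  then show ?thesis using tendsto_Pair[OF v t(1)] by blast
qed

end

theorem theorem4p4:
  fixes \<phi> :: "'x::banach \<Rightarrow> ereal"
    and f :: "'x \<times> 'h::{real_inner, banach} \<Rightarrow> ereal"
    and A :: "'h \<Rightarrow> 'h"
    and \<sigma> :: "'h \<Rightarrow> ereal"
    and \<epsilon> \<delta> \<alpha>max \<alpha>bar \<eta> \<beta> :: real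
    and \<alpha> \<rho> s c r :: "nat \<Rightarrow> real"
    and x :: "nat \<Rightarrow> 'x"
    and y z :: "nat \<Rightarrow> 'h"
  assumes "reflexive_space TYPE('x)"
    and "proper_fun \<phi>" and "w_lsc \<phi>" and "\<And>a::real. weakly_compact {u. \<phi> u \<le> ereal a}"
    and "\<And>u. f (u, 0) = \<phi> u"
    and "proper_fun f" and "w_lsc f" and "weakly_level_compact f"
    and "augmenting_fun \<sigma>"
    and "\<And>w. ereal (norm (A w)) \<le> \<sigma> w"
    and "\<And>v. w_usc (\<lambda>w. ereal (A w \<bullet> v))"
    and "\<exists>yb cb. cb \<ge> 0 \<and> dual_fun f A \<sigma> yb cb > -\<infinity>"
    and "dsg_run f A \<sigma> \<epsilon> \<delta> \<alpha>max \<alpha> \<rho> s y c x z r"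
    and "dsg1_stepsizes A \<sigma> \<eta> \<beta> s z"
    and "\<alpha>bar > 0" and "\<And>k. \<alpha> k \<ge> \<alpha>bar"
  shows
    "((\<forall>w :: nat \<Rightarrow> 'h. decseq (\<lambda>k. \<sigma> (w k)) \<and> (\<lambda>k. \<sigma> (w k)) \<longlonglongrightarrow> 0 \<longrightarrow> bounded (range w)) \<and>
      primal_value \<phi> = dual_value f A \<sigma> \<and>
      bounded (range (\<lambda>k. (y k, c k)))
      \<longrightarrow> dual_solutions f A \<sigma> \<noteq> {} \<and>
          (\<exists>d \<in> dual_solutions f A \<sigma>. (\<lambda>k. (y k, c k)) \<longlonglongrightarrow> d))
     \<and>
     (\<forall>R yh ch S.
        R > 0 \<and> (\<forall>k. ereal (r k) \<le> ereal R * \<sigma> (z k)) \<and>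
        ch \<ge> 0 \<and> dual_fun f A \<sigma> yh ch > -\<infinity> \<and> ereal S \<ge> primal_value \<phi> \<and>
        (coercive_fun \<sigma> \<and> y 0 = yh \<and> c 0 > ch
         \<or> (\<exists>K rt. cond_coercive \<sigma> K \<and> y 0 = yh \<and>
              ereal (c 0) > ereal ch + (ereal S - dual_fun f A \<sigma> yh ch) / ereal K \<and>
              (\<forall>k. r k \<le> rt) \<and>
              ereal (\<alpha> 0 * s 0) >
                (primal_value \<phi> - dual_fun f A \<sigma> (y 0) (c 0) + ereal rt) / (ereal K * \<sigma> (z 0)))) \<and>
        dual_solutions f A \<sigma> \<noteq> {}
        \<longrightarrow> (\<exists>d \<in> dual_solutions f A \<sigma>. (\<lambda>k. (y k, c k)) \<longlonglongrightarrow> d))"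
proof -
  interpret dsg1 \<phi> f A \<sigma> \<epsilon> \<delta> \<alpha>max \<eta> \<beta> \<alpha> \<rho> s c r x y z
    by unfold_locales (fact assms)+
  have "dual_solutions f A \<sigma> \<noteq> {} \<and> (\<exists>d \<in> dual_solutions f A \<sigma>. (\<lambda>k. (y k, c k)) \<longlonglongrightarrow> d)"
    if "\<forall>w :: nat \<Rightarrow> 'h. decseq (\<lambda>k. \<sigma> (w k)) \<and> (\<lambda>k. \<sigma> (w k)) \<longlonglongrightarrow> 0 \<longrightarrow> bounded (range w)"
      "primal_value \<phi> = dual_value f A \<sigma>" "bounded (range (\<lambda>k. (y k, c k)))"
  proof -
    have "bounded (range c)"
      using bounded_snd[OF that(3)] by (simp add: image_image)
    then show ?thesis
      using convergent_to_dual_solution that(1,2) by blast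
  qed
  moreover have "\<exists>d \<in> dual_solutions f A \<sigma>. (\<lambda>k. (y k, c k)) \<longlonglongrightarrow> d"
    if R: "\<forall>k. ereal (r k) \<le> ereal R * \<sigma> (z k)"
      and yh: "dual_fun f A \<sigma> yh ch > -\<infinity>"
      and cases: "coercive_fun \<sigma> \<and> y 0 = yh \<and> c 0 > ch
         \<or> (\<exists>K rt. cond_coercive \<sigma> K \<and> y 0 = yh \<and>
              ereal (c 0) > ereal ch + (ereal S - dual_fun f A \<sigma> yh ch) / ereal K \<and>
              (\<forall>k. r k \<le> rt) \<and>
              ereal (\<alpha> 0 * s 0) >
                (primal_value \<phi> - dual_fun f A \<sigma> (y 0) (c 0) + ereal rt) / (ereal K * \<sigma> (z 0)))"
      and ne: "dual_solutions f A \<sigma> \<noteq> {}"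
    for R yh ch S
  proof -
    \<comment> \<open>The penalty bound is anchored at \<open>ch\<close>, below \<open>c 0\<close>,
      in the coercive case and at \<open>c 0\<close> itself in the conditionally coercive
      one.\<close>
    have "bounded (range sg) \<and> bounded (range z)"
      using cases coercive_bounded[of ch] cond_coercive_bounded yh by blast
    moreover have "r k \<le> R * sg k" for k using R by (simp add: sg)
    ultimately show ?thesis using ne dual_solution_limit[of _ R] by blast
  qed
  ultimately show ?thesis by blast
qed

end
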